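(* Let $n\ge 3$ and let $P_1=(x_1,y_1),\dots,P_n=(x_n,y_n)$ be $n$ points in $\mathbb{R}^2$ with $x_1<\cdots<x_n$. Then the segments $\overline{P_1P_2},\overline{P_2P_3},\dots,\overline{P_{n-1}P_n},\overline{P_nP_1}$ form a convex $n$-gon lying in the half-plane $$\Big\{(x,y)\in\mathbb{R}^2 : y_1+\Big(\frac{y_n-y_1}{x_n-x_1}\Big)(x-x_1)\le y\Big\}$$ if and only if $$\frac{y_i-y_{i-1}}{x_i-x_{i-1}}\ge\frac{y_{i+1}-y_i}{x_{i+1}-x_i}\qquad\text{for all } i\in\{2,\dots,n-1\}.$$
   Context: For points $P_1,\dots,P_n\in\mathbb{R}^2$, $\overline{PQ}$ denotes the closed line segment with endpoints $P,Q$. The segments $\overline{P_1P_2},\dots,\overline{P_{n-1}P_n},\overline{P_nP_1}$ are said to form a convex $n$-gon if their union equals the topological boundary (in $\mathbb{R}^2$) of the convex hull of $\{P_1,\dots,P_n\}$; the $n$-gon is this convex hull. Degenerate cases are allowed: consecutive vertices may be collinear with their neighbours (angles equal to $\pi$), and all points may even lie on one line, in which case the convex hull is a segment equal to its own boundary. The $n$-gon lies in a half-plane if the convex hull is contained in it. *)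

theory Defs
  imports "HOL-Analysis.Analysis"
begin

text \<open>Vertices are indexed from 1 to n; values of P outside this range are irrelevant.\<close>

definition convex_ngon :: "nat \<Rightarrow> (nat \<Rightarrow> real \<times> real) \<Rightarrow> (real \<times> real) set" where
  "convex_ngon n P = convex hull (P ` {1..n})"

text \<open>The frontier is taken in the plane, so if all vertices are collinear the hull is a segment
  and equals its own frontier; such degenerate polygons are allowed.\<close>

definition form_convex_ngon :: "nat \<Rightarrow> (nat \<Rightarrow> real \<times> real) \<Rightarrow> bool" where
  "form_convex_ngon n P \<longleftrightarrow>
     (\<Union>i\<in>{1..<n}. closed_segment (P i) (P (i + 1))) \<union> closed_segment (P n) (P 1)
       = frontier (convex_ngon n P)"

end

theory Submission
  imports Defs
begin

text \<open>
  The vertices form a chain that runs from left to right, so over each abscissa \<open>u\<close> the polygonal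
  curve has at most two points: one on the chain and one on the closing edge, which is the chord
  from the first vertex to the last.

  If the curve is the frontier of the hull and the hull lies above the chord, then the highest
  point of the hull over the abscissa of an inner vertex is a frontier point, hence is that vertex
  or the point of the chord below it. So no point of the hull is directly above the vertex; in
  particular the segment joining its two neighbours passes at or below it, which is the comparison
  of slopes (\<open>slopes_decreasing_if_frontier\<close>).

  If conversely the slopes decrease, then every vertex is at or below the line through each edge
  (\<open>vertex_below_edge_line\<close>), and so the hull is cut out by linear inequalities: it consists of the
  points between the first and the last abscissa that are above the chord and below all edge
  lines (\<open>hull_eq_region\<close>). A point of the hull for which all these inequalities are strict is
  interior; a point where the inequality of the chord or of an edge is tight is not, since it can
  be pushed out of the hull vertically. What remains is to see that tightness of an inequality
  means lying on the curve (\<open>frontier_hull_eq_curve\<close>). This reasoning does not need the hull to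
  have interior points, so it covers collinear vertices as well.
\<close>

section \<open>Non-vertical lines and segments in the plane\<close>

definition slope :: "real \<times> real \<Rightarrow> real \<times> real \<Rightarrow> real" where
  "slope p q = (snd q - snd p) / (fst q - fst p)"

definition line_through :: "real \<times> real \<Rightarrow> real \<times> real \<Rightarrow> real \<Rightarrow> real" where
  "line_through p q u = snd p + slope p q * (u - fst p)"

lemma line_through_left [simp]: "line_through p q (fst p) = snd p"
  by (simp add: line_through_def)

lemma line_through_right [simp]: "fst p < fst q \<Longrightarrow> line_through p q (fst q) = snd q"
  by (simp add: line_through_def slope_def)

lemma line_through_affine:
  assumes "a + b = 1"
  shows "line_through p q (a * u + b * v) = a * line_through p q u + b * line_through p q v"
proof -
  have "b = 1 - a"
    using assms by simp
  show ?thesis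
    unfolding line_through_def \<open>b = 1 - a\<close> by (simp add: algebra_simps)
qed

lemma continuous_on_line_through: "continuous_on S (\<lambda>z. line_through p q (fst z))"
  unfolding line_through_def by (intro continuous_intros)

lemma convex_below_line: "convex {z. snd z \<le> line_through p q (fst z)}"
  unfolding convex_def
  by (auto simp: line_through_affine intro!: add_mono mult_left_mono)

lemma convex_above_line: "convex {z. line_through p q (fst z) \<le> snd z}"
  unfolding convex_def
  by (auto simp: line_through_affine intro!: add_mono mult_left_mono)

lemma mem_closed_segment_iff_line:
  assumes "fst p < fst q"
  shows "z \<in> closed_segment p q \<longleftrightarrow>
           fst p \<le> fst z \<and> fst z \<le> fst q \<and> snd z = line_through p q (fst z)"
proof
  assume "z \<in> closed_segment p q"
  then obtain t where t: "0 \<le> t" "t \<le> 1" "z = (1 - t) *\<^sub>R p + t *\<^sub>R q"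
    by (auto simp: closed_segment_def)
  have fz: "fst z = (1 - t) * fst p + t * fst q"
    using t(3) by simp
  have "fst z \<in> closed_segment (fst p) (fst q)"
    unfolding closed_segment_def using fz t(1,2) by auto
  then have "fst p \<le> fst z \<and> fst z \<le> fst q"
    using assms by (simp add: closed_segment_eq_real_ivl)
  moreover have "snd z = line_through p q (fst z)"
    unfolding fz using assms t(3) by (simp add: line_through_affine)
  ultimately show "fst p \<le> fst z \<and> fst z \<le> fst q \<and> snd z = line_through p q (fst z)"
    by simp
next
  assume z: "fst p \<le> fst z \<and> fst z \<le> fst q \<and> snd z = line_through p q (fst z)"
  then have "fst z \<in> closed_segment (fst p) (fst q)"
    using assms by (simp add: closed_segment_eq_real_ivl)
  then obtain t where t: "0 \<le> t" "t \<le> 1" "fst z = (1 - t) * fst p + t * fst q"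
    by (auto simp: closed_segment_def)
  have "snd z = (1 - t) * snd p + t * snd q"
    using z assms unfolding t(3) by (simp add: line_through_affine)
  then have "z = (1 - t) *\<^sub>R p + t *\<^sub>R q"
    using t(3) by (simp add: prod_eq_iff)
  then show "z \<in> closed_segment p q"
    using t(1,2) by (auto simp: closed_segment_def)
qed

lemma slope_le_if_line_below:
  assumes "fst p < fst q" "fst q < fst r" "line_through p r (fst q) \<le> snd q"
  shows "slope q r \<le> slope p q"
proof -
  define a b c d where "a = fst q - fst p" and "b = fst r - fst q"
    and "c = snd q - snd p" and "d = snd r - snd q"
  have "a > 0" "b > 0"
    using assms by (auto simp: a_def b_def)
  have "(c + d) / (a + b) * a \<le> c"
    using assms(3) unfolding line_through_def slope_def a_def b_def c_def d_def by simp
  then have "d * a \<le> c * b"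
    using \<open>a > 0\<close> \<open>b > 0\<close> by (simp add: field_simps)
  then have "d / b \<le> c / a"
    using \<open>a > 0\<close> \<open>b > 0\<close> by (simp add: field_simps)
  then show ?thesis
    unfolding slope_def a_def b_def c_def d_def .
qed

section \<open>Moving vertically inside a plane set\<close>

lemma interior_vertical_neighbours:
  fixes S :: "(real \<times> real) set"
  assumes "(u, v) \<in> interior S"
  obtains e where "e > 0" "(u, v + e) \<in> S" "(u, v - e) \<in> S"
proof -
  obtain e where e: "e > 0" "cball (u, v) e \<subseteq> S"
    using assms by (auto simp: mem_interior_cball)
  have "(u, v + e) \<in> cball (u, v) e" "(u, v - e) \<in> cball (u, v) e"
    using e(1) by (auto simp: dist_prod_def dist_real_def)
  with e that show thesis
    by blast
qed

lemma topmost_point_in_frontier: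
  fixes S :: "(real \<times> real) set"
  assumes "compact S" "(u, v) \<in> S"
  obtains t where "(u, t) \<in> frontier S" "\<And>w. (u, w) \<in> S \<Longrightarrow> w \<le> t"
proof -
  have "closed {z :: real \<times> real. fst z = u}"
    by (intro closed_Collect_eq continuous_intros)
  then have "compact (S \<inter> {z. fst z = u})"
    using assms(1) by (rule compact_Int_closed[rotated])
  moreover have "S \<inter> {z. fst z = u} \<noteq> {}"
    using assms(2) by auto
  ultimately obtain z where z: "z \<in> S \<inter> {z. fst z = u}"
    "\<forall>w \<in> S \<inter> {z. fst z = u}. snd w \<le> snd z"
    using continuous_attains_sup continuous_on_snd[OF continuous_on_id] by metis
  have top: "w \<le> snd z" if "(u, w) \<in> S" for w
    using z(2) that by force
  have "z = (u, snd z)"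
    using z(1) by (auto simp: prod_eq_iff)
  moreover have "z \<notin> interior S"
  proof
    assume "z \<in> interior S"
    then have "(u, snd z) \<in> interior S"
      using \<open>z = (u, snd z)\<close> by simp
    then show False
      by (rule interior_vertical_neighbours) (use top in force)
  qed
  ultimately have "(u, snd z) \<in> frontier S"
    using z(1) closure_subset by (auto simp: frontier_def)
  with top that show thesis
    by blast
qed

section \<open>Chains of points running from left to right\<close>

locale chain =
  fixes n :: nat and P :: "nat \<Rightarrow> real \<times> real"
  assumes two_points: "2 \<le> n"
    and increasing: "strict_mono_on {1..n} (\<lambda>i. fst (P i))"
begin

definition curve :: "(real \<times> real) set" where
  "curve = (\<Union>i\<in>{1..<n}. closed_segment (P i) (P (i + 1))) \<union> closed_segment (P n) (P 1)"

abbreviation edge_line :: "nat \<Rightarrow> real \<Rightarrow> real" where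
  "edge_line i \<equiv> line_through (P i) (P (i + 1))"

abbreviation chord :: "real \<Rightarrow> real" where
  "chord \<equiv> line_through (P 1) (P n)"

lemma fst_less: "1 \<le> i \<Longrightarrow> i < j \<Longrightarrow> j \<le> n \<Longrightarrow> fst (P i) < fst (P j)"
  using increasing by (auto simp: strict_mono_on_def)

lemma fst_le: "1 \<le> i \<Longrightarrow> i \<le> j \<Longrightarrow> j \<le> n \<Longrightarrow> fst (P i) \<le> fst (P j)"
  using fst_less[of i j] by (cases "i = j") auto

lemma first_less_last: "fst (P 1) < fst (P n)"
  using two_points by (intro fst_less) auto

lemma mem_curve_iff:
  "z \<in> curve \<longleftrightarrow>
     (\<exists>i\<in>{1..<n}. fst (P i) \<le> fst z \<and> fst z \<le> fst (P (i + 1)) \<and> snd z = edge_line i (fst z)) \<or>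
     fst (P 1) \<le> fst z \<and> fst z \<le> fst (P n) \<and> snd z = chord (fst z)"
proof -
  have "z \<in> closed_segment (P i) (P (i + 1)) \<longleftrightarrow>
          fst (P i) \<le> fst z \<and> fst z \<le> fst (P (i + 1)) \<and> snd z = edge_line i (fst z)"
    if "i \<in> {1..<n}" for i
    using that by (intro mem_closed_segment_iff_line fst_less) auto
  then show ?thesis
    unfolding curve_def
    by (simp add: closed_segment_commute[of "P n"] mem_closed_segment_iff_line first_less_last
        del: One_nat_def)
qed

lemma edge_above:
  assumes "fst (P 1) \<le> u" "u \<le> fst (P n)"
  obtains j where "j \<in> {1..<n}" "fst (P j) \<le> u" "u \<le> fst (P (j + 1))"
proof -
  have "\<exists>j\<in>{1..<m}. fst (P j) \<le> u \<and> u \<le> fst (P (j + 1))" if "2 \<le> m" "u \<le> fst (P m)" for m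
    using that
  proof (induction m rule: dec_induct)
    case base
    then show ?case
      using assms(1) by (intro bexI[of _ 1]) (auto simp: numeral_2_eq_2)
  next
    case (step m)
    show ?case
    proof (cases "u \<le> fst (P m)")
      case True
      then obtain j where "j \<in> {1..<m}" "fst (P j) \<le> u \<and> u \<le> fst (P (j + 1))"
        using step.IH by blast
      then show ?thesis
        by (intro bexI[of _ j]) auto
    next
      case False
      then show ?thesis
        using step.hyps step.prems by (intro bexI[of _ m]) auto
    qed
  qed
  then show thesis
    using two_points assms(2) that by blast
qed

lemma compact_hull: "compact (convex_ngon n P)"
  unfolding convex_ngon_def by (intro finite_imp_compact_convex_hull) auto

lemma segment_subset_hull:
  assumes "i \<in> {1..n}" "j \<in> {1..n}"
  shows "closed_segment (P i) (P j) \<subseteq> convex_ngon n P"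
  unfolding convex_ngon_def
  by (intro closed_segment_subset convex_convex_hull hull_inc) (use assms in auto)

lemma line_point_in_hull:
  assumes "1 \<le> i" "i < j" "j \<le> n" "fst (P i) \<le> u" "u \<le> fst (P j)"
  shows "(u, line_through (P i) (P j) u) \<in> convex_ngon n P"
proof -
  have "(u, line_through (P i) (P j) u) \<in> closed_segment (P i) (P j)"
    using assms fst_less by (simp add: mem_closed_segment_iff_line)
  then show ?thesis
    using segment_subset_hull[of i j] assms by auto
qed

section \<open>The frontier condition forces decreasing slopes\<close>

text \<open>The only edges of the chain that reach the abscissa of a vertex are the ones that end at the
  vertex.\<close>

lemma curve_over_vertex:
  assumes "i \<in> {1..n}" "(fst (P i), t) \<in> curve"
  shows "t = snd (P i) \<or> t = chord (fst (P i))"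
proof -
  have "t = snd (P i)"
    if j: "j \<in> {1..<n}" "fst (P j) \<le> fst (P i)" "fst (P i) \<le> fst (P (j + 1))"
      and t: "t = edge_line j (fst (P i))" for j
  proof -
    have "\<not> i < j" "\<not> j + 1 < i"
      using j assms(1) fst_less[of i j] fst_less[of "j + 1" i] by auto
    then consider "i = j" | "i = j + 1"
      by linarith
    then show ?thesis
    proof cases
      case 2
      then show ?thesis
        using t j(1) fst_less[of j "j + 1"] by simp
    qed (use t in simp)
  qed
  then show ?thesis
    using assms(2) by (auto simp: mem_curve_iff)
qed

lemma slopes_decreasing_if_frontier:
  assumes curve: "curve = frontier (convex_ngon n P)"
    and above: "\<And>z. z \<in> convex_ngon n P \<Longrightarrow> chord (fst z) \<le> snd z"
    and i: "1 < i" "i < n"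
  shows "slope (P i) (P (i + 1)) \<le> slope (P (i - 1)) (P i)"
proof -
  have Pi: "P i \<in> convex_ngon n P"
    using i by (auto simp: convex_ngon_def intro!: hull_inc)
  then have "(fst (P i), snd (P i)) \<in> convex_ngon n P"
    by simp
  then obtain t where t: "(fst (P i), t) \<in> frontier (convex_ngon n P)"
    and top: "\<And>w. (fst (P i), w) \<in> convex_ngon n P \<Longrightarrow> w \<le> t"
    using topmost_point_in_frontier[OF compact_hull] by metis
  have "t \<le> snd (P i)"
    using curve_over_vertex[of i t] t curve above[OF Pi] i by auto
  moreover have less: "fst (P (i - 1)) < fst (P i)" "fst (P i) < fst (P (i + 1))"
    using i by (auto intro!: fst_less)
  moreover have "(fst (P i), line_through (P (i - 1)) (P (i + 1)) (fst (P i))) \<in> convex_ngon n P"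
    using less i by (intro line_point_in_hull) auto
  ultimately show ?thesis
    using top by (intro slope_le_if_line_below) fastforce+
qed

end

section \<open>Chains with decreasing slopes\<close>

locale concave_chain = chain +
  assumes slopes_decreasing:
    "\<And>i. 1 < i \<Longrightarrow> i < n \<Longrightarrow> slope (P i) (P (i + 1)) \<le> slope (P (i - 1)) (P i)"
begin

lemma slopes_antimono:
  assumes "1 \<le> i" "i \<le> j" "j < n"
  shows "slope (P j) (P (j + 1)) \<le> slope (P i) (P (i + 1))"
  using assms(2,3)
proof (induction j rule: dec_induct)
  case (step j)
  then show ?case
    using slopes_decreasing[of "Suc j"] assms(1) by simp
qed simp

text \<open>Walking away from edge \<open>i\<close> along the chain, no further edge climbs relative to the line
  through edge \<open>i\<close>: to its right the slopes are at most that of the line, and to its left, where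
  edges are traversed backwards, they are at least that of the line.\<close>

lemma vertex_below_edge_line:
  assumes i: "1 \<le> i" "i < n" and k: "1 \<le> k" "k \<le> n"
  shows "snd (P k) \<le> edge_line i (fst (P k))"
proof -
  have rise: "snd (P (j + 1)) = snd (P j) + slope (P j) (P (j + 1)) * (fst (P (j + 1)) - fst (P j))"
    if "1 \<le> j" "j < n" for j
    using fst_less[of j "j + 1"] that by (simp add: slope_def)
  have line: "edge_line i (fst (P (j + 1))) =
      edge_line i (fst (P j)) + slope (P i) (P (i + 1)) * (fst (P (j + 1)) - fst (P j))" for j
    by (simp add: line_through_def algebra_simps)
  show ?thesis
  proof (cases "i \<le> k")
    case True
    then show ?thesis
      using k(2)
    proof (induction k rule: dec_induct)
      case (step j)
      have "slope (P j) (P (j + 1)) * (fst (P (j + 1)) - fst (P j))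
              \<le> slope (P i) (P (i + 1)) * (fst (P (j + 1)) - fst (P j))"
        using step.hyps step.prems i fst_less[of j "j + 1"]
        by (intro mult_right_mono slopes_antimono) auto
      then show ?case
        using rise[of j] line[of j] step i by simp
    qed simp
  next
    case False
    then have "k \<le> i"
      by simp
    then show ?thesis
      using k(1)
    proof (induction k rule: inc_induct)
      case (step j)
      have "slope (P i) (P (i + 1)) * (fst (P (j + 1)) - fst (P j))
              \<le> slope (P j) (P (j + 1)) * (fst (P (j + 1)) - fst (P j))"
        using step.hyps step.prems i fst_less[of j "j + 1"]
        by (intro mult_right_mono slopes_antimono) auto
      then show ?case
        using rise[of j] line[of j] step i by simp
    qed simp
  qed
qed

text \<open>Both end points of the chord are on or below the line through the edge that starts at vertex \<open>k\<close>,
  and this line passes through the vertex.\<close>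

lemma vertex_above_chord:
  assumes "1 \<le> k" "k \<le> n"
  shows "chord (fst (P k)) \<le> snd (P k)"
proof (cases "k = n")
  case True
  then show ?thesis
    using first_less_last by simp
next
  case False
  let ?H = "{z. snd z \<le> edge_line k (fst z)}"
  have "closed_segment (P 1) (P n) \<subseteq> ?H"
    using assms False two_points
    by (intro closed_segment_subset convex_below_line)
      (use vertex_below_edge_line[of k 1] vertex_below_edge_line[of k n] in auto)
  moreover have "(fst (P k), chord (fst (P k))) \<in> closed_segment (P 1) (P n)"
    using assms fst_le[of 1 k] fst_le[of k n] 
    by (simp add: mem_closed_segment_iff_line first_less_last del: One_nat_def)
  ultimately show ?thesis
    by auto
qed

section \<open>The hull of a chain with decreasing slopes and its frontier\<close>

text \<open>The bounds on the abscissa follow from the other inequalities unless all vertices are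
  collinear; in that case the other inequalities describe a whole line.\<close>

definition region :: "(real \<times> real) set" where
  "region = {z. fst (P 1) \<le> fst z \<and> fst z \<le> fst (P n) \<and> chord (fst z) \<le> snd z \<and>
               (\<forall>i\<in>{1..<n}. snd z \<le> edge_line i (fst z))}"

lemma convex_region: "convex region"
proof -
  have "convex {z :: real \<times> real. fst (P 1) \<le> fst z}" "convex {z :: real \<times> real. fst z \<le> fst (P n)}"
    using convex_linear_vimage[OF linear_fst, of "{fst (P 1)..}"]
      convex_linear_vimage[OF linear_fst, of "{..fst (P n)}"]
    by (simp_all add: vimage_def)
  moreover have "region = {z. fst (P 1) \<le> fst z} \<inter> {z. fst z \<le> fst (P n)} \<inter>
      {z. chord (fst z) \<le> snd z} \<inter> (\<Inter>i\<in>{1..<n}. {z. snd z \<le> edge_line i (fst z)})"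
    by (auto simp: region_def)
  ultimately show ?thesis
    by (auto intro!: convex_Int convex_INT convex_above_line convex_below_line)
qed

lemma hull_eq_region: "convex_ngon n P = region"
proof
  have "P k \<in> region" if "k \<in> {1..n}" for k
    using that vertex_above_chord[of k] vertex_below_edge_line[of _ k] fst_le[of 1 k] fst_le[of k n]
    by (auto simp: region_def)
  then show "convex_ngon n P \<subseteq> region"
    unfolding convex_ngon_def by (intro hull_minimal convex_region) auto
next
  show "region \<subseteq> convex_ngon n P"
  proof
    fix z
    assume "z \<in> region"
    then have z: "fst (P 1) \<le> fst z" "fst z \<le> fst (P n)" "chord (fst z) \<le> snd z"
      "\<And>i. i \<in> {1..<n} \<Longrightarrow> snd z \<le> edge_line i (fst z)"
      by (auto simp: region_def)
    obtain j where j: "j \<in> {1..<n}" "fst (P j) \<le> fst z" "fst z \<le> fst (P (j + 1))"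
      using edge_above z(1,2) by blast
    let ?lo = "(fst z, chord (fst z))" and ?hi = "(fst z, edge_line j (fst z))"
    have "?lo \<in> convex_ngon n P"
      using line_point_in_hull[of 1 n "fst z"] z two_points by simp
    moreover have "?hi \<in> convex_ngon n P"
      using line_point_in_hull[of j "j + 1" "fst z"] j by simp
    ultimately have "closed_segment ?lo ?hi \<subseteq> convex_ngon n P"
      unfolding convex_ngon_def by (intro closed_segment_subset convex_convex_hull)
    moreover have "z \<in> closed_segment ?lo ?hi"
    proof -
      have "snd z \<in> closed_segment (chord (fst z)) (edge_line j (fst z))"
        using z(3) z(4)[OF j(1)] by (auto simp: closed_segment_eq_real_ivl)
      then show ?thesis
        by (auto simp: closed_segment_def prod_eq_iff algebra_simps)
    qed
    ultimately show "z \<in> convex_ngon n P"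
      by blast
  qed
qed

lemma region_interior_if_strict:
  assumes "fst (P 1) < fst z" "fst z < fst (P n)" "chord (fst z) < snd z"
    and "\<And>i. i \<in> {1..<n} \<Longrightarrow> snd z < edge_line i (fst z)"
  shows "z \<in> interior region"
proof (rule interiorI)
  let ?U = "{z :: real \<times> real. fst (P 1) < fst z} \<inter> {z. fst z < fst (P n)} \<inter>
      {z. chord (fst z) < snd z} \<inter> (\<Inter>i\<in>{1..<n}. {z. snd z < edge_line i (fst z)})"
  show "open ?U"
    by (intro open_Int open_INT open_Collect_less ballI continuous_on_line_through continuous_intros)
      auto
  show "z \<in> ?U"
    using assms by auto
  show "?U \<subseteq> region"
    by (auto simp: region_def intro: less_imp_le)
qed

lemma frontier_hull_eq_curve: "frontier (convex_ngon n P) = curve"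
proof -
  have "frontier (convex_ngon n P) = region - interior region"
    using compact_hull by (simp add: frontier_def compact_imp_closed hull_eq_region)
  also have "\<dots> = curve"
  proof
    show "region - interior region \<subseteq> curve"
    proof
      fix z
      assume z: "z \<in> region - interior region"
      then have bounds: "fst (P 1) \<le> fst z" "fst z \<le> fst (P n)" "chord (fst z) \<le> snd z"
        "\<And>i. i \<in> {1..<n} \<Longrightarrow> snd z \<le> edge_line i (fst z)"
        by (auto simp: region_def)
      obtain j where j: "j \<in> {1..<n}" "fst (P j) \<le> fst z" "fst z \<le> fst (P (j + 1))"
        using edge_above bounds(1,2) by blast
      show "z \<in> curve"
      proof (rule ccontr)
        assume off: "z \<notin> curve"
        then have above: "chord (fst z) < snd z"
          using bounds by (auto simp: mem_curve_iff)
        have "snd z < edge_line j (fst z)"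
          using off j bounds(4)[OF j(1)] by (auto simp: mem_curve_iff)
        \<comment> \<open>Edge \<open>j\<close> is part of the hull, so it is on or below every edge line.\<close>
        moreover have "edge_line j (fst z) \<le> edge_line i (fst z)" if "i \<in> {1..<n}" for i
          using line_point_in_hull[of j "j + 1" "fst z"] j that
          by (simp add: hull_eq_region region_def)
        ultimately have below: "snd z < edge_line i (fst z)" if "i \<in> {1..<n}" for i
          using that by fastforce
        \<comment> \<open>At the two extreme abscissas the chord meets an edge, which leaves no room for \<open>z\<close>.\<close>
        have "fst z \<noteq> fst (P 1)"
          using above below[of 1] two_points by fastforce
        moreover have "fst z \<noteq> fst (P n)"
          using above below[of "n - 1"] two_points first_less_last fst_less[of "n - 1" n] by fastforce
        ultimately show False
          using region_interior_if_strict[of z] above below bounds(1,2) z by auto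
      qed
    qed
  next
    show "curve \<subseteq> region - interior region"
    proof
      fix z
      assume z: "z \<in> curve"
      have "curve \<subseteq> region"
        unfolding curve_def hull_eq_region[symmetric]
        using two_points by (intro Un_least UN_least segment_subset_hull) auto
      moreover have "z \<notin> interior region"
      proof
        assume "z \<in> interior region"
        then have "(fst z, snd z) \<in> interior region"
          by simp
        then obtain e where "e > 0" "(fst z, snd z + e) \<in> region" "(fst z, snd z - e) \<in> region"
          by (rule interior_vertical_neighbours)
        then show False
          using z by (fastforce simp: mem_curve_iff region_def)
      qed
      ultimately show "z \<in> region - interior region"
        using z by blast
    qed
  qed
  finally show ?thesis .
qed

end

section \<open>Convex polygons with one edge below all the others\<close>

theorem theorem1p4:
  fixes n :: nat and x y :: "nat \<Rightarrow> real" and P :: "nat \<Rightarrow> real \<times> real"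
  assumes "n \<ge> 3"
    and "\<And>i. i \<in> {1..n} \<Longrightarrow> P i = (x i, y i)"
    and "strict_mono_on {1..n} x"
  shows "form_convex_ngon n P \<and>
           convex_ngon n P \<subseteq> {(u, v). y 1 + ((y n - y 1) / (x n - x 1)) * (u - x 1) \<le> v}
     \<longleftrightarrow>
         (\<forall>i\<in>{2..n - 1}. (y i - y (i - 1)) / (x i - x (i - 1))
                         \<ge> (y (i + 1) - y i) / (x (i + 1) - x i))"
    (is "?polygon \<and> convex_ngon n P \<subseteq> ?halfplane \<longleftrightarrow> ?slopes")
proof -
  interpret chain n P
    using assms by unfold_locales (auto simp: strict_mono_on_def)
  have polygon: "?polygon \<longleftrightarrow> curve = frontier (convex_ngon n P)"
    by (simp add: form_convex_ngon_def curve_def)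
  have halfplane: "?halfplane = {z. chord (fst z) \<le> snd z}"
    using assms(1,2) by (auto simp: line_through_def slope_def)
  have slopes: "?slopes \<longleftrightarrow>
      (\<forall>i. 1 < i \<longrightarrow> i < n \<longrightarrow> slope (P i) (P (i + 1)) \<le> slope (P (i - 1)) (P i))"
  proof -
    have "(i \<in> {2..n - 1} \<longrightarrow> (y i - y (i - 1)) / (x i - x (i - 1))
            \<ge> (y (i + 1) - y i) / (x (i + 1) - x i))
      \<longleftrightarrow> (1 < i \<longrightarrow> i < n \<longrightarrow> slope (P i) (P (i + 1)) \<le> slope (P (i - 1)) (P i))" for i
    proof (cases "1 < i \<and> i < n")
      case True
      then have "i - 1 \<in> {1..n}" "i \<in> {1..n}" "i + 1 \<in> {1..n}"
        by auto
      from this[THEN assms(2)] have "P (i - 1) = (x (i - 1), y (i - 1))" "P i = (x i, y i)"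
        "P (i + 1) = (x (i + 1), y (i + 1))"
        by blast+
      moreover have "i \<in> {2..n - 1}"
        using True by auto
      ultimately show ?thesis
        using True by (simp add: slope_def)
    next
      case False
      then show ?thesis
        by auto
    qed
    then show ?thesis
      by (simp only: Ball_def)
  qed
  show ?thesis
  proof
    assume "?polygon \<and> convex_ngon n P \<subseteq> ?halfplane"
    then show ?slopes
      unfolding polygon halfplane slopes using slopes_decreasing_if_frontier by blast
  next
    assume ?slopes
    then interpret concave_chain n P
      unfolding slopes by unfold_locales blast
    have "convex_ngon n P \<subseteq> {z. chord (fst z) \<le> snd z}"
      unfolding hull_eq_region region_def by blast
    then show "?polygon \<and> convex_ngon n P \<subseteq> ?halfplane"
      unfolding polygon halfplane by (simp add: frontier_hull_eq_curve)
  qed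
qed

end
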